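(* If $A$ and $B$ are graph automatic groups, then their free product $A\star B$ is graph automatic.
   Context: For a finite alphabet $\Sigma$, let $\Sigma^\star$ be the set of finite strings over $\Sigma$. For strings $w_1,\dots,w_n\in\Sigma^\star$ the convolution $\otimes(w_1,\dots,w_n)$ is the string of length $\max_i|w_i|$ over the alphabet $(\Sigma\cup\{\diamond\})^n$ (with $\diamond\notin\Sigma$) whose $k$-th symbol is $(\sigma_1,\dots,\sigma_n)$, where $\sigma_i$ is the $k$-th symbol of $w_i$ if $k\le|w_i|$ and $\sigma_i=\diamond$ otherwise. A relation $R\subseteq(\Sigma^\star)^n$ is FA recognizable if $\{\otimes(w_1,\dots,w_n)\mid (w_1,\dots,w_n)\in R\}$ is a regular language (recognized by a finite automaton). Let $G$ be a group generated by a finite set $X$. Its Cayley graph $\Gamma(G,X)$ is viewed as the structure $(G;(E_x)_{x\in X})$ with $E_x=\{(g,gx)\mid g\in G\}$. The group $G$ is graph automatic with respect to $X$ if there are a finite alphabet $\Sigma$, a regular language $R\subseteq\Sigma^\star$ and a bijection $\nu:R\to G$ such that for each $x\in X$ the relation $\{(u,v)\in R^2\mid \nu(u)x=\nu(v)\}$ is FA recognizable. A finitely generated group is graph automatic if it is graph automatic with respect to some finite generating set. *)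

theory Defs
  imports "HOL-Algebra.Generated_Groups"
begin

section \<open>Finite automata and FA recognizable relations\<close>

record ('q, 's) dfa =
  states :: "'q set"
  init :: 'q
  accepting :: "'q set"
  step :: "'q \<Rightarrow> 's \<Rightarrow> 'q"

definition is_dfa :: "'s set \<Rightarrow> ('q, 's) dfa \<Rightarrow> bool" where
  "is_dfa S M \<longleftrightarrow> finite (states M) \<and> init M \<in> states M \<and> accepting M \<subseteq> states M \<and>
     (\<forall>q\<in>states M. \<forall>s\<in>S. step M q s \<in> states M)"

definition language :: "'s set \<Rightarrow> ('q, 's) dfa \<Rightarrow> 's list set" where
  "language S M = {w \<in> lists S. foldl (step M) (init M) w \<in> accepting M}"

text \<open>State sets are drawn from \<^typ>\<open>nat\<close>. This is no restriction, since the states of a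
  finite automaton can be renamed.\<close>

definition regular :: "'s set \<Rightarrow> 's list set \<Rightarrow> bool" where
  "regular S L \<longleftrightarrow> finite S \<and> (\<exists>M :: (nat, 's) dfa. is_dfa S M \<and> L = language S M)"

text \<open>Tuples of strings are lists of strings; the padding symbol is \<^const>\<open>None\<close>.
  The \<^term>\<open>0\<close> only serves to give the empty tuple a length.\<close>

definition conv :: "'s list list \<Rightarrow> 's option list list" where
  "conv ws = map (\<lambda>k. map (\<lambda>w. if k < length w then Some (w ! k) else None) ws)
                 [0..<Max (insert 0 (length ` set ws))]"

definition conv_alphabet :: "'s set \<Rightarrow> nat \<Rightarrow> 's option list set" where
  "conv_alphabet S n = {c. length c = n \<and> set c \<subseteq> insert None (Some ` S)}"

definition FA_recognizable :: "'s set \<Rightarrow> nat \<Rightarrow> 's list list set \<Rightarrow> bool" where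
  "FA_recognizable S n R \<longleftrightarrow>
     R \<subseteq> {ws. length ws = n \<and> set ws \<subseteq> lists S} \<and> regular (conv_alphabet S n) (conv ` R)"

section \<open>Graph automatic groups\<close>

text \<open>Alphabets are finite sets of natural numbers, again up to renaming of symbols.
  \<^const>\<open>generate\<close> yields the generated subgroup, so generating sets need not be closed
  under inverses.\<close>

definition graph_automatic_wrt :: "('a, 'm) monoid_scheme \<Rightarrow> 'a set \<Rightarrow> bool" where
  "graph_automatic_wrt G X \<longleftrightarrow>
     (\<exists>(S :: nat set) (R :: nat list set) (\<nu> :: nat list \<Rightarrow> 'a).
        finite S \<and> regular S R \<and> bij_betw \<nu> R (carrier G) \<and>
        (\<forall>x\<in>X. FA_recognizable S 2
           {[u, v] | u v. u \<in> R \<and> v \<in> R \<and> \<nu> u \<otimes>\<^bsub>G\<^esub> x = \<nu> v}))"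

definition graph_automatic :: "('a, 'm) monoid_scheme \<Rightarrow> bool" where
  "graph_automatic G \<longleftrightarrow> group G \<and>
     (\<exists>X. finite X \<and> X \<subseteq> carrier G \<and> generate G X = carrier G \<and> graph_automatic_wrt G X)"

section \<open>Free products\<close>

text \<open>The free product consists of the reduced words: nontrivial letters alternately from the
  two factors. \<open>fp_cons A B s w\<close> is the reduced form of the letter \<open>s\<close> followed by the
  reduced word \<open>w\<close>.\<close>

definition fp_letters ::
  "('a, 'm) monoid_scheme \<Rightarrow> ('b, 'n) monoid_scheme \<Rightarrow> ('a + 'b) set" where
  "fp_letters A B = Inl ` (carrier A - {\<one>\<^bsub>A\<^esub>}) \<union> Inr ` (carrier B - {\<one>\<^bsub>B\<^esub>})"

definition fp_words ::
  "('a, 'm) monoid_scheme \<Rightarrow> ('b, 'n) monoid_scheme \<Rightarrow> ('a + 'b) list set" where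
  "fp_words A B = {w \<in> lists (fp_letters A B). successively (\<lambda>s t. isl s \<noteq> isl t) w}"

fun fp_cons :: "('a, 'm) monoid_scheme \<Rightarrow> ('b, 'n) monoid_scheme \<Rightarrow>
    'a + 'b \<Rightarrow> ('a + 'b) list \<Rightarrow> ('a + 'b) list" where
  "fp_cons A B (Inl a) (Inl a' # w) =
     (if a \<otimes>\<^bsub>A\<^esub> a' = \<one>\<^bsub>A\<^esub> then w else Inl (a \<otimes>\<^bsub>A\<^esub> a') # w)"
| "fp_cons A B (Inr b) (Inr b' # w) =
     (if b \<otimes>\<^bsub>B\<^esub> b' = \<one>\<^bsub>B\<^esub> then w else Inr (b \<otimes>\<^bsub>B\<^esub> b') # w)"
| "fp_cons A B s w = s # w"

definition free_product :: "('a, 'm) monoid_scheme \<Rightarrow> ('b, 'n) monoid_scheme \<Rightarrow>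
    ('a + 'b) list monoid"  (infixl \<open>\<star>\<close> 70) where
  "A \<star> B = \<lparr>carrier = fp_words A B, mult = (\<lambda>u v. foldr (fp_cons A B) u v), one = []\<rparr>"

definition fp_inl :: "('a, 'm) monoid_scheme \<Rightarrow> 'a \<Rightarrow> ('a + 'b) list" where
  "fp_inl A a = (if a = \<one>\<^bsub>A\<^esub> then [] else [Inl a])"

definition fp_inr :: "('b, 'n) monoid_scheme \<Rightarrow> 'b \<Rightarrow> ('a + 'b) list" where
  "fp_inr B b = (if b = \<one>\<^bsub>B\<^esub> then [] else [Inr b])"

text \<open>This is a group and has the universal property of the coproduct.\<close>

lemma free_product_simps [simp]:
  "carrier (A \<star> B) = fp_words A B"
  "mult (A \<star> B) u v = foldr (fp_cons A B) u v"
  "one (A \<star> B) = []"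
  by (simp_all add: free_product_def)

lemma fp_words_Nil [simp]: "[] \<in> fp_words A B"
  by (simp add: fp_words_def)

lemma fp_words_Cons:
  "s # w \<in> fp_words A B \<longleftrightarrow>
     s \<in> fp_letters A B \<and> w \<in> fp_words A B \<and> (w = [] \<or> isl s \<noteq> isl (hd w))"
  by (cases w) (auto simp: fp_words_def)

lemma Inl_letter [simp]: "Inl a \<in> fp_letters A B \<longleftrightarrow> a \<in> carrier A \<and> a \<noteq> \<one>\<^bsub>A\<^esub>"
  and Inr_letter [simp]: "Inr b \<in> fp_letters A B \<longleftrightarrow> b \<in> carrier B \<and> b \<noteq> \<one>\<^bsub>B\<^esub>"
  by (auto simp: fp_letters_def)

context
  fixes A :: "('a, 'm) monoid_scheme" and B :: "('b, 'n) monoid_scheme"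
  assumes A: "group A" and B: "group B"
begin

interpretation A: group A by (rule A)
interpretation B: group B by (rule B)

lemma fp_cons_closed:
  assumes "s \<in> fp_letters A B" "w \<in> fp_words A B"
  shows "fp_cons A B s w \<in> fp_words A B"
  using assms
  by (cases "(A, B, s, w)" rule: fp_cons.cases) (auto simp: fp_words_Cons)

lemma foldr_fp_cons_closed:
  assumes "u \<in> lists (fp_letters A B)" "w \<in> fp_words A B"
  shows "foldr (fp_cons A B) u w \<in> fp_words A B"
  using assms by (induction u) (auto intro: fp_cons_closed)

lemma fp_cons_Inl_Inl:
  assumes "a \<in> carrier A" "a' \<in> carrier A" "a \<noteq> \<one>\<^bsub>A\<^esub>" "a' \<noteq> \<one>\<^bsub>A\<^esub>" "w \<in> fp_words A B"
  shows "fp_cons A B (Inl a) (fp_cons A B (Inl a') w) =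
    (if a \<otimes>\<^bsub>A\<^esub> a' = \<one>\<^bsub>A\<^esub> then w else fp_cons A B (Inl (a \<otimes>\<^bsub>A\<^esub> a')) w)"
proof (cases "\<exists>c w'. w = Inl c # w'")
  case False
  then have "fp_cons A B (Inl x) w = Inl x # w" for x
    by (cases w rule: list.exhaust; cases "hd w") auto
  then show ?thesis by simp
next
  case True
  then obtain c w' where w: "w = Inl c # w'" by blast
  have c: "c \<in> carrier A" "c \<noteq> \<one>\<^bsub>A\<^esub>" and w': "w' = [] \<or> \<not> isl (hd w')"
    using assms(5) by (auto simp: w fp_words_Cons)
  have nl: "fp_cons A B (Inl a) w' = Inl a # w'"
    using w' by (cases w'; cases "hd w'") auto
  have assoc: "a \<otimes>\<^bsub>A\<^esub> (a' \<otimes>\<^bsub>A\<^esub> c) = (a \<otimes>\<^bsub>A\<^esub> a') \<otimes>\<^bsub>A\<^esub> c"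
    using assms c by (simp add: A.m_assoc)
  show ?thesis
  proof (cases "a' \<otimes>\<^bsub>A\<^esub> c = \<one>\<^bsub>A\<^esub>")
    case T: True
    then have "(a \<otimes>\<^bsub>A\<^esub> a') \<otimes>\<^bsub>A\<^esub> c = a" using assoc assms by simp
    moreover have "a = c" if "a \<otimes>\<^bsub>A\<^esub> a' = \<one>\<^bsub>A\<^esub>"
      using calculation that c by simp
    ultimately show ?thesis using T assms nl by (auto simp: w)
  next
    case F: False
    then show ?thesis using assms c assoc by (auto simp: w)
  qed
qed

lemma fp_cons_Inr_Inr:
  assumes "b \<in> carrier B" "b' \<in> carrier B" "b \<noteq> \<one>\<^bsub>B\<^esub>" "b' \<noteq> \<one>\<^bsub>B\<^esub>" "w \<in> fp_words A B"
  shows "fp_cons A B (Inr b) (fp_cons A B (Inr b') w) =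
    (if b \<otimes>\<^bsub>B\<^esub> b' = \<one>\<^bsub>B\<^esub> then w else fp_cons A B (Inr (b \<otimes>\<^bsub>B\<^esub> b')) w)"
proof (cases "\<exists>c w'. w = Inr c # w'")
  case False
  then have "fp_cons A B (Inr x) w = Inr x # w" for x
    by (cases w rule: list.exhaust; cases "hd w") auto
  then show ?thesis by simp
next
  case True
  then obtain c w' where w: "w = Inr c # w'" by blast
  have c: "c \<in> carrier B" "c \<noteq> \<one>\<^bsub>B\<^esub>" and w': "w' = [] \<or> isl (hd w')"
    using assms(5) by (auto simp: w fp_words_Cons)
  have nl: "fp_cons A B (Inr b) w' = Inr b # w'"
    using w' by (cases w'; cases "hd w'") auto
  have assoc: "b \<otimes>\<^bsub>B\<^esub> (b' \<otimes>\<^bsub>B\<^esub> c) = (b \<otimes>\<^bsub>B\<^esub> b') \<otimes>\<^bsub>B\<^esub> c"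
    using assms c by (simp add: B.m_assoc)
  show ?thesis
  proof (cases "b' \<otimes>\<^bsub>B\<^esub> c = \<one>\<^bsub>B\<^esub>")
    case T: True
    then have "(b \<otimes>\<^bsub>B\<^esub> b') \<otimes>\<^bsub>B\<^esub> c = b" using assoc assms by simp
    moreover have "b = c" if "b \<otimes>\<^bsub>B\<^esub> b' = \<one>\<^bsub>B\<^esub>"
      using calculation that c by simp
    ultimately show ?thesis using T assms nl by (auto simp: w)
  next
    case F: False
    then show ?thesis using assms c assoc by (auto simp: w)
  qed
qed

lemma foldr_fp_cons:
  assumes "s \<in> fp_letters A B" "v \<in> fp_words A B" "w \<in> fp_words A B"
  shows "foldr (fp_cons A B) (fp_cons A B s v) w = fp_cons A B s (foldr (fp_cons A B) v w)"
proof -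
  have cl: "foldr (fp_cons A B) v' w \<in> fp_words A B" if "v' \<in> fp_words A B" for v'
    using that assms(3) by (intro foldr_fp_cons_closed) (simp_all add: fp_words_def)
  show ?thesis
    using assms(1,2)
    by (cases "(A, B, s, v)" rule: fp_cons.cases)
       (auto simp: fp_words_Cons fp_cons_Inl_Inl fp_cons_Inr_Inr cl)
qed

lemma foldr_fp_cons_assoc:
  assumes "u \<in> lists (fp_letters A B)" "v \<in> fp_words A B" "w \<in> fp_words A B"
  shows "foldr (fp_cons A B) (foldr (fp_cons A B) u v) w =
    foldr (fp_cons A B) u (foldr (fp_cons A B) v w)"
  using assms by (induction u) (auto simp: foldr_fp_cons foldr_fp_cons_closed)

lemma fp_words_lists: "u \<in> fp_words A B \<Longrightarrow> u \<in> lists (fp_letters A B)"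
  by (simp add: fp_words_def)

lemma foldr_fp_cons_Nil: "u \<in> fp_words A B \<Longrightarrow> foldr (fp_cons A B) u [] = u"
proof (induction u)
  case (Cons s u)
  then show ?case
    by (cases "(A, B, s, u)" rule: fp_cons.cases) (auto simp: fp_words_Cons)
qed simp

lemma fp_left_inverse: "u \<in> fp_words A B \<Longrightarrow> \<exists>v\<in>fp_words A B. foldr (fp_cons A B) v u = []"
proof (induction u)
  case (Cons s u)
  then obtain v where v: "v \<in> fp_words A B" "foldr (fp_cons A B) v u = []"
    by (auto simp: fp_words_Cons)
  define t :: "'a + 'b" where "t = map_sum (m_inv A) (m_inv B) s"
  have t: "t \<in> fp_letters A B" "fp_cons A B t (s # u) = u"
    using Cons.prems by (auto simp: t_def fp_words_Cons fp_letters_def)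
  have t': "[t] \<in> fp_words A B" using t by (simp add: fp_words_Cons)
  have "foldr (fp_cons A B) (foldr (fp_cons A B) v [t]) (s # u) = []"
    using foldr_fp_cons_assoc[OF fp_words_lists[OF v(1)] t' Cons.prems] t v by simp
  then show ?case
    using foldr_fp_cons_closed[OF fp_words_lists[OF v(1)] t'] by blast
qed (auto intro: bexI[of _ "[]"])

lemma group_free_product: "group (A \<star> B)"
  by (rule groupI)
     (auto simp: foldr_fp_cons_closed foldr_fp_cons_assoc fp_words_lists fp_left_inverse)

lemma fp_inl_hom: "fp_inl A \<in> hom A (A \<star> B)"
  by (auto simp: hom_def fp_inl_def fp_words_Cons)

lemma fp_inr_hom: "fp_inr B \<in> hom B (A \<star> B)"
  by (auto simp: hom_def fp_inr_def fp_words_Cons)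

lemma free_product_universal:
  fixes H :: "('c, 'k) monoid_scheme"
  assumes H: "group H" and f: "f \<in> hom A H" and g: "g \<in> hom B H"
  obtains h where "h \<in> hom (A \<star> B) H"
    and "\<And>a. a \<in> carrier A \<Longrightarrow> h (fp_inl A a) = f a"
    and "\<And>b. b \<in> carrier B \<Longrightarrow> h (fp_inr B b) = g b"
    and "\<And>h' w. \<lbrakk>h' \<in> hom (A \<star> B) H; \<And>a. a \<in> carrier A \<Longrightarrow> h' (fp_inl A a) = f a;
           \<And>b. b \<in> carrier B \<Longrightarrow> h' (fp_inr B b) = g b; w \<in> carrier (A \<star> B)\<rbrakk>
         \<Longrightarrow> h' w = h w"
proof -
  interpret H: group H by (rule H)
  interpret f: group_hom A H f by unfold_locales (rule f)
  interpret g: group_hom B H g by unfold_locales (rule g)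
  define h where "h w = foldr (\<lambda>s y. case_sum f g s \<otimes>\<^bsub>H\<^esub> y) w \<one>\<^bsub>H\<^esub>" for w
  have h_Nil [simp]: "h [] = \<one>\<^bsub>H\<^esub>"
    and h_Cons [simp]: "\<And>s w. h (s # w) = case_sum f g s \<otimes>\<^bsub>H\<^esub> h w"
    by (simp_all add: h_def)
  have letter: "case_sum f g s \<in> carrier H" if "s \<in> fp_letters A B" for s
    using that by (auto simp: fp_letters_def)
  have cl: "h w \<in> carrier H" if "w \<in> lists (fp_letters A B)" for w
    using that by (induction w) (auto simp: letter)
  have cons: "h (fp_cons A B s w) = case_sum f g s \<otimes>\<^bsub>H\<^esub> h w"
    if "s \<in> fp_letters A B" "w \<in> fp_words A B" for s w
  proof (cases "(A, B, s, w)" rule: fp_cons.cases)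
    case (1 A' B' a a' v)
    then have "h v \<in> carrier H" using that by (auto simp: fp_words_Cons intro!: cl fp_words_lists)
    moreover have "f a \<otimes>\<^bsub>H\<^esub> f a' = f (a \<otimes>\<^bsub>A\<^esub> a')"
      using 1 that hom_mult[OF f, of a a'] by (auto simp: fp_words_Cons)
    moreover have "f a \<in> carrier H" "f a' \<in> carrier H"
      using 1 that by (auto simp: fp_words_Cons intro!: hom_in_carrier[OF f])
    ultimately show ?thesis using 1 that hom_one[OF f A H]
      by (auto simp: fp_words_Cons H.m_assoc[symmetric])
  next
    case (2 A' B' a a' v)
    then have "h v \<in> carrier H" using that by (auto simp: fp_words_Cons intro!: cl fp_words_lists)
    moreover have "g a \<otimes>\<^bsub>H\<^esub> g a' = g (a \<otimes>\<^bsub>B\<^esub> a')"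
      using 2 that hom_mult[OF g, of a a'] by (auto simp: fp_words_Cons)
    moreover have "g a \<in> carrier H" "g a' \<in> carrier H"
      using 2 that by (auto simp: fp_words_Cons intro!: hom_in_carrier[OF g])
    ultimately show ?thesis using 2 that hom_one[OF g B H]
      by (auto simp: fp_words_Cons H.m_assoc[symmetric])
  qed auto
  have mult: "h (foldr (fp_cons A B) u v) = h u \<otimes>\<^bsub>H\<^esub> h v"
    if "u \<in> lists (fp_letters A B)" "v \<in> fp_words A B" for u v
    using that
    by (induction u)
       (auto simp: cons foldr_fp_cons_closed cl fp_words_lists letter H.m_assoc)
  show thesis
  proof
    show "h \<in> hom (A \<star> B) H"
      by (auto simp: hom_def mult cl fp_words_lists)
    show "h (fp_inl A a) = f a" if "a \<in> carrier A" for a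
      using that by (auto simp: fp_inl_def)
    show "h (fp_inr B b) = g b" if "b \<in> carrier B" for b
      using that by (auto simp: fp_inr_def)
    fix h' w
    assume h': "h' \<in> hom (A \<star> B) H"
      and l: "\<And>a. a \<in> carrier A \<Longrightarrow> h' (fp_inl A a) = f a"
      and r: "\<And>b. b \<in> carrier B \<Longrightarrow> h' (fp_inr B b) = g b"
      and w: "w \<in> carrier (A \<star> B)"
    have single: "h' [s] = case_sum f g s" if "s \<in> fp_letters A B" for s
    proof (cases s)
      case (Inl a)
      then show ?thesis using that l[of a] by (simp add: fp_inl_def)
    next
      case (Inr b)
      then show ?thesis using that r[of b] by (simp add: fp_inr_def)
    qed
    from w have "w \<in> fp_words A B" by simp
    then show "h' w = h w"
    proof (induction w)
      case Nil
      show ?case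
        using hom_one[OF h' group_free_product H] by simp
    next
      case (Cons s w)
      then have s: "[s] \<in> fp_words A B" "w \<in> fp_words A B" "s \<in> fp_letters A B"
        by (auto simp: fp_words_Cons)
      have "foldr (fp_cons A B) [s] w = s # w"
        using foldr_fp_cons_Nil[OF Cons.prems] foldr_fp_cons_Nil[OF s(2)] by simp
      then have "h' (s # w) = h' [s] \<otimes>\<^bsub>H\<^esub> h' w"
        using hom_mult[OF h', of "[s]" w] s by simp
      then show ?case using Cons.IH s single by simp
    qed
  qed
qed

end

end

theory Submission
  imports Defs
begin

text \<open>
  A language over a finite alphabet is regular iff it has finitely many left quotients
  (Myhill--Nerode), which makes the closure properties of regular languages short set computations.

  Fix a representation of each factor. A reduced word is encoded by concatenating the
  representatives of its letters, over disjoint alphabets for the two factors and with a marker in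
  front of each letter; the code is thus an alternating concatenation of two regular languages.
  Every reduced word is \<open>p a\<close> with \<open>a\<close> a possibly trivial element of \<open>A\<close> and \<open>p\<close> not ending in \<open>A\<close>,
  and for a generator \<open>x\<close> of \<open>A\<close> we have \<open>(p a) x = p (a x)\<close>. The convolution of the two codes is the
  diagonal of the code of \<open>p\<close> followed by the convolution of the codes of \<open>a\<close> and \<open>a x\<close>. The latter
  comes from the edge relation of \<open>A\<close>, up to the at most two edges at the identity of \<open>A\<close>, which
  is encoded by the empty word instead of a marked representative.
\<close>

section \<open>Regular languages and left quotients\<close>

text \<open>\<open>w\<close> ranges over all lists of the type, so that finiteness can be stated
  without an alphabet. For \<open>L\<close> over an alphabet, prefixes with foreign symbols only
  contribute the empty quotient.\<close>

definition quotients :: "'s list set \<Rightarrow> 's list set set" where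
  "quotients L = range (\<lambda>w. {v. w @ v \<in> L})"

text \<open>The quotient by a word depends only on the state that the word reaches; conversely the
  quotients themselves are the states of an automaton.\<close>

lemma regular_iff_finite_quotients:
  fixes S :: "'s set"
  shows "regular S L \<longleftrightarrow> finite S \<and> L \<subseteq> lists S \<and> finite (quotients L)"
proof
  assume "regular S L"
  then obtain M :: "(nat, 's) dfa" where "finite S" and M: "is_dfa S M" and L: "L = language S M"
    by (auto simp: regular_def)
  have closed: "foldl (step M) q w \<in> states M" if "q \<in> states M" "w \<in> lists S" for q w
    using that M by (induction w arbitrary: q) (auto simp: is_dfa_def)
  have "quotients L \<subseteq>
    insert {} ((\<lambda>q. {v \<in> lists S. foldl (step M) q v \<in> accepting M}) ` states M)"
  proof
    fix K assume "K \<in> quotients L"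
    then obtain w where K: "K = {v. w @ v \<in> L}" by (auto simp: quotients_def)
    show "K \<in> insert {} ((\<lambda>q. {v \<in> lists S. foldl (step M) q v \<in> accepting M}) ` states M)"
    proof (cases "w \<in> lists S")
      case True
      then have "foldl (step M) (init M) w \<in> states M"
        using closed M by (auto simp: is_dfa_def)
      moreover have "K = {v \<in> lists S. foldl (step M) (foldl (step M) (init M) w) v \<in> accepting M}"
        using True by (auto simp: K L language_def)
      ultimately show ?thesis by blast
    next
      case False
      then have "K = {}" by (auto simp: K L language_def)
      then show ?thesis by simp
    qed
  qed
  then have "finite (quotients L)"
    by (rule finite_subset) (use M in \<open>auto simp: is_dfa_def\<close>)
  then show "finite S \<and> L \<subseteq> lists S \<and> finite (quotients L)"
    using \<open>finite S\<close> by (auto simp: L language_def)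
next
  assume *: "finite S \<and> L \<subseteq> lists S \<and> finite (quotients L)"
  then have "finite (quotients L)" by simp
  \<comment> \<open>Automata have states in \<open>nat\<close>, so the quotients are numbered by an
    injection \<open>f\<close>, and \<open>step\<close> decodes a number with
    \<open>inv_into\<close>.\<close>
  from finite_imp_inj_to_nat_seg[OF this]
  obtain f :: "'s list set \<Rightarrow> nat" where inj: "inj_on f (quotients L)"
    by (elim exE conjE)
  define M :: "(nat, 's) dfa" where
    "M = \<lparr>states = f ` quotients L, init = f L, accepting = f ` {K \<in> quotients L. [] \<in> K},
          step = \<lambda>q s. f {v. s # v \<in> inv_into (quotients L) f q}\<rparr>"
  have L: "L \<in> quotients L"
    unfolding quotients_def by (rule range_eqI[of _ _ "[]"]) simp
  have closed: "{v. w @ v \<in> K} \<in> quotients L" if K: "K \<in> quotients L" for w K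
  proof -
    obtain u where "K = {v. u @ v \<in> L}" using K by (auto simp: quotients_def)
    then show ?thesis unfolding quotients_def by (intro range_eqI[of _ _ "u @ w"]) simp
  qed
  have step: "step M (f K) s = f {v. s # v \<in> K}" if "K \<in> quotients L" for K s
    using that inj by (simp add: M_def)
  have foldl: "foldl (step M) (f K) w = f {v. w @ v \<in> K}" if "K \<in> quotients L" for K w
    using that
  proof (induction w arbitrary: K)
    case (Cons s w)
    then show ?case using closed[of K "[s]"] by (simp add: step)
  qed simp
  have "step M q s \<in> states M" if q: "q \<in> states M" for q s
  proof -
    obtain K where K: "K \<in> quotients L" "q = f K" using q by (auto simp: M_def)
    then have "step M q s = f {v. [s] @ v \<in> K}" by (simp add: step)
    then show ?thesis using closed[OF K(1)] by (simp add: M_def del: append.simps)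
  qed
  then have "is_dfa S M"
    using * L by (simp add: is_dfa_def) (auto simp: M_def)
  moreover have "foldl (step M) (init M) w \<in> accepting M \<longleftrightarrow> w \<in> L" for w
  proof -
    have "foldl (step M) (init M) w = f {v. w @ v \<in> L}"
      using foldl[OF L] by (simp add: M_def)
    moreover have "{v. w @ v \<in> L} \<in> quotients L" by (simp add: quotients_def)
    ultimately show ?thesis
      using inj_on_image_mem_iff[OF inj, of "{v. w @ v \<in> L}" "{K \<in> quotients L. [] \<in> K}"]
      by (simp add: M_def)
  qed
  ultimately have "is_dfa S M \<and> L = language S M"
    using * by (auto simp: language_def)
  then show "regular S L" using * unfolding regular_def by blast
qed

section \<open>Closure properties of the languages with finitely many quotients\<close>

definition conc :: "'s list set \<Rightarrow> 's list set \<Rightarrow> 's list set" where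
  "conc L M = {u @ v | u v. u \<in> L \<and> v \<in> M}"

lemma concI: "u \<in> L \<Longrightarrow> v \<in> M \<Longrightarrow> u @ v \<in> conc L M"
  by (auto simp: conc_def)

lemma conc_singleton: "conc {[s]} L = (#) s ` L"
  by (auto simp: conc_def)

lemma concE:
  assumes "w \<in> conc L M"
  obtains u v where "w = u @ v" "u \<in> L" "v \<in> M"
  using assms by (auto simp: conc_def)

inductive_set star :: "'s list set \<Rightarrow> 's list set" for L where
  Nil: "[] \<in> star L"
| append: "u \<in> L \<Longrightarrow> v \<in> star L \<Longrightarrow> u @ v \<in> star L"

text \<open>Taking the quotient by a fixed word commutes with Boolean operations, so a quotient of
  the result is determined by a pair of quotients. The same argument serves for differences.\<close>

lemma finite_quotients_Un:
  assumes "finite (quotients L)" "finite (quotients M)"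
  shows "finite (quotients (L \<union> M))"
proof (rule finite_subset)
  show "quotients (L \<union> M) \<subseteq> (\<lambda>(X, Y). X \<union> Y) ` (quotients L \<times> quotients M)"
  proof
    fix K assume "K \<in> quotients (L \<union> M)"
    then obtain w where K: "K = {v. w @ v \<in> L} \<union> {v. w @ v \<in> M}"
      by (auto simp: quotients_def)
    have "{v. w @ v \<in> L} \<in> quotients L" "{v. w @ v \<in> M} \<in> quotients M"
      by (auto simp: quotients_def)
    then show "K \<in> (\<lambda>(X, Y). X \<union> Y) ` (quotients L \<times> quotients M)"
      unfolding K by (intro rev_image_eqI[OF SigmaI]) auto
  qed
qed (use assms in simp)

lemma finite_quotients_Diff:
  assumes "finite (quotients L)" "finite (quotients M)"
  shows "finite (quotients (L - M))"
proof (rule finite_subset)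
  show "quotients (L - M) \<subseteq> (\<lambda>(X, Y). X - Y) ` (quotients L \<times> quotients M)"
  proof
    fix K assume "K \<in> quotients (L - M)"
    then obtain w where K: "K = {v. w @ v \<in> L} - {v. w @ v \<in> M}"
      by (auto simp: quotients_def)
    have "{v. w @ v \<in> L} \<in> quotients L" "{v. w @ v \<in> M} \<in> quotients M"
      by (auto simp: quotients_def)
    then show "K \<in> (\<lambda>(X, Y). X - Y) ` (quotients L \<times> quotients M)"
      unfolding K by (intro rev_image_eqI[OF SigmaI]) auto
  qed
qed (use assms in simp)

text \<open>The border between the two factors lies either after \<open>w\<close>, leaving a
  quotient of \<open>L\<close> followed by \<open>M\<close>, or inside \<open>w\<close>, leaving a
  quotient of \<open>M\<close>. Many borders inside \<open>w\<close> are possible, but the sets they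
  yield form a subset of the finite set \<open>quotients M\<close>.\<close>

lemma finite_quotients_conc:
  assumes "finite (quotients L)" "finite (quotients M)"
  shows "finite (quotients (conc L M))"
proof (rule finite_subset)
  show "quotients (conc L M) \<subseteq>
    (\<lambda>(X, \<Y>). conc X M \<union> \<Union>\<Y>) ` (quotients L \<times> Pow (quotients M))"
  proof
    fix K assume "K \<in> quotients (conc L M)"
    then obtain w where K: "K = {v. w @ v \<in> conc L M}" by (auto simp: quotients_def)
    define X where "X = {v. w @ v \<in> L}"
    define \<Y> where "\<Y> = {{v. w2 @ v \<in> M} | w1 w2. w = w1 @ w2 \<and> w1 \<in> L}"
    have "K = conc X M \<union> \<Union>\<Y>"
    proof
      show "K \<subseteq> conc X M \<union> \<Union>\<Y>"
      proof
        fix v assume "v \<in> K"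
        then obtain x y where "w @ v = x @ y" and xy: "x \<in> L" "y \<in> M" by (auto simp: K conc_def)
        then consider t where "x = w @ t" "v = t @ y" | t where "w = x @ t" "y = t @ v"
          by (metis append_eq_append_conv2)
        then show "v \<in> conc X M \<union> \<Union>\<Y>"
        proof cases
          case 1
          then show ?thesis using xy by (auto simp: conc_def X_def)
        next
          case 2
          then have "{v. t @ v \<in> M} \<in> \<Y>" using xy by (auto simp: \<Y>_def)
          then show ?thesis using 2 xy by auto
        qed
      qed
      show "conc X M \<union> \<Union>\<Y> \<subseteq> K"
      proof
        fix v assume "v \<in> conc X M \<union> \<Union>\<Y>"
        then consider x y where "v = x @ y" "w @ x \<in> L" "y \<in> M"
          | w1 w2 where "w = w1 @ w2" "w1 \<in> L" "w2 @ v \<in> M"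
          by (auto simp: conc_def X_def \<Y>_def)
        then have "\<exists>x y. w @ v = x @ y \<and> x \<in> L \<and> y \<in> M"
        proof cases
          case 1
          then show ?thesis by (intro exI[of _ "w @ x"] exI[of _ y]) simp
        next
          case 2
          then show ?thesis by (intro exI[of _ w1] exI[of _ "w2 @ v"]) simp
        qed
        then show "v \<in> K" by (simp add: K conc_def)
      qed
    qed
    moreover have "X \<in> quotients L" "\<Y> \<subseteq> quotients M"
      by (auto simp: X_def \<Y>_def quotients_def)
    ultimately show "K \<in> (\<lambda>(X, \<Y>). conc X M \<union> \<Union>\<Y>) ` (quotients L \<times> Pow (quotients M))"
      by blast
  qed
qed (use assms in simp)

lemma star_append: "u \<in> star L \<Longrightarrow> v \<in> star L \<Longrightarrow> u @ v \<in> star L"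
  by (induction u rule: star.induct) (auto intro: star.intros)

text \<open>The end of \<open>w\<close> falls inside or at the end of some factor from
  \<open>L\<close>, here \<open>w2 @ v1\<close>. A nonempty \<open>w\<close> rules out the empty
  product, which has no factor.\<close>

lemma star_split:
  assumes "w @ v \<in> star L" "w \<noteq> []"
  obtains w1 w2 v1 v2 where "w = w1 @ w2" "v = v1 @ v2" "w1 \<in> star L" "w2 @ v1 \<in> L" "v2 \<in> star L"
  using assms
proof (induction "w @ v" arbitrary: w thesis rule: star.induct)
  case Nil
  then show ?case by simp
next
  case (append x y)
  \<comment> \<open>A border exactly at the end of \<open>x\<close> goes into the first case, so
    that \<open>t\<close> is nonempty in the second and the induction hypothesis applies to
    it.\<close>
  from append.hyps(4) consider t where "x = w @ t" "v = t @ y" | t where "t \<noteq> []" "w = x @ t" "y = t @ v"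
    by (auto simp: append_eq_append_conv2) (metis append_Nil append_Nil2)
  then show ?case
  proof cases
    case 1
    then show ?thesis using append.prems(1)[of "[]" w t y] append.hyps by (auto intro: star.Nil)
  next
    case 2
    then obtain w1 w2 v1 v2 where "t = w1 @ w2" "v = v1 @ v2" "w1 \<in> star L" "w2 @ v1 \<in> L" "v2 \<in> star L"
      using append.hyps(3) by blast
    then show ?thesis using append.prems(1)[of "x @ w1" w2 v1 v2] append.hyps 2
      by (auto intro: star.append)
  qed
qed

text \<open>By \<open>star_split\<close>, what may follow a nonempty \<open>w\<close> is the rest of
  an unfinished factor and then further factors. The empty \<open>w\<close> gives
  \<open>star L\<close> itself, hence the \<open>insert\<close>.\<close>

lemma finite_quotients_star:
  assumes "finite (quotients L)"
  shows "finite (quotients (star L))"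
proof (rule finite_subset)
  show "quotients (star L) \<subseteq>
    insert (star L) ((\<lambda>\<Y>. conc (\<Union>\<Y>) (star L)) ` Pow (quotients L))"
  proof
    fix K assume "K \<in> quotients (star L)"
    then obtain w where K: "K = {v. w @ v \<in> star L}" by (auto simp: quotients_def)
    show "K \<in> insert (star L) ((\<lambda>\<Y>. conc (\<Union>\<Y>) (star L)) ` Pow (quotients L))"
    proof (cases "w = []")
      case False
      define \<Y> where "\<Y> = {{v. w2 @ v \<in> L} | w1 w2. w = w1 @ w2 \<and> w1 \<in> star L}"
      have "K = conc (\<Union>\<Y>) (star L)"
      proof
        show "K \<subseteq> conc (\<Union>\<Y>) (star L)"
        proof
          fix v assume "v \<in> K"
          then obtain w1 w2 v1 v2 where
            *: "w = w1 @ w2" "v = v1 @ v2" "w1 \<in> star L" "w2 @ v1 \<in> L" "v2 \<in> star L"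
            using star_split[OF _ False] unfolding K by (metis mem_Collect_eq)
          then have "v1 \<in> \<Union>\<Y>" by (auto simp: \<Y>_def)
          then show "v \<in> conc (\<Union>\<Y>) (star L)" using * by (auto simp: conc_def)
        qed
        show "conc (\<Union>\<Y>) (star L) \<subseteq> K"
        proof
          fix v assume "v \<in> conc (\<Union>\<Y>) (star L)"
          then obtain w1 w2 v1 v2 where "w = w1 @ w2" "v = v1 @ v2" "w1 \<in> star L" "w2 @ v1 \<in> L" "v2 \<in> star L"
            by (auto simp: \<Y>_def conc_def)
          then show "v \<in> K" using star_append[of w1 L, OF _ star.append[of "w2 @ v1" L v2]]
            by (simp add: K)
        qed
      qed
      moreover have "\<Y> \<subseteq> quotients L"
        by (auto simp: \<Y>_def quotients_def)
      ultimately show ?thesis by blast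
    qed (simp add: K)
  qed
qed (use assms in simp)

text \<open>\<open>f\<close> may identify symbols, so all preimages of \<open>w\<close> count: the
  quotient is the image of a union of quotients of \<open>L\<close>.\<close>

lemma finite_quotients_map:
  assumes "finite (quotients L)"
  shows "finite (quotients (map f ` L))"
proof (rule finite_subset)
  show "quotients (map f ` L) \<subseteq> (\<lambda>\<Y>. map f ` \<Union>\<Y>) ` Pow (quotients L)"
  proof
    fix K assume "K \<in> quotients (map f ` L)"
    then obtain w where K: "K = {v. w @ v \<in> map f ` L}" by (auto simp: quotients_def)
    define \<Y> where "\<Y> = {{v. u @ v \<in> L} | u. map f u = w}"
    have "K = map f ` \<Union>\<Y>"
    proof
      show "K \<subseteq> map f ` \<Union>\<Y>"
      proof
        fix v assume "v \<in> K"
        then obtain x y where xy: "x @ y \<in> L" "w = map f x" "v = map f y"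
          by (auto simp: K append_eq_map_conv)
        then have "{v. x @ v \<in> L} \<in> \<Y>" by (auto simp: \<Y>_def)
        then show "v \<in> map f ` \<Union>\<Y>" using xy by auto
      qed
      show "map f ` \<Union>\<Y> \<subseteq> K"
        by (auto simp: K \<Y>_def simp flip: map_append)
    qed
    moreover have "\<Y> \<subseteq> quotients L"
      by (auto simp: \<Y>_def quotients_def)
    ultimately show "K \<in> (\<lambda>\<Y>. map f ` \<Union>\<Y>) ` Pow (quotients L)" by blast
  qed
qed (use assms in simp)

text \<open>A quotient consists of suffixes of words of \<open>L\<close>, of which there are
  finitely many.\<close>

lemma finite_quotients_finite:
  assumes "finite L"
  shows "finite (quotients L)"
proof (rule finite_subset)
  define T where "T = (\<Union>u\<in>L. (\<lambda>n. drop n u) ` {..length u})"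
  show "quotients L \<subseteq> Pow T"
  proof -
    have "v \<in> T" if "w @ v \<in> L" for w v
      unfolding T_def using that by (auto intro!: bexI[of _ "w @ v"] image_eqI[of _ _ "length w"])
    then show ?thesis by (auto simp: quotients_def)
  qed
  show "finite (Pow T)" using assms by (simp add: T_def)
qed

lemma finite_quotients_insert:
  assumes "finite (quotients L)"
  shows "finite (quotients (insert w L))"
  using finite_quotients_Un[OF finite_quotients_finite[of "{w}"] assms] by simp

section \<open>Convolutions of pairs\<close>

lemma conv_pair:
  "conv [u, v] = map (\<lambda>k. [if k < length u then Some (u ! k) else None,
                          if k < length v then Some (v ! k) else None])
                     [0..<max (length u) (length v)]"
  by (simp add: conv_def)

lemma upt_0_Suc: "[0..<Suc n] = 0 # map Suc [0..<n]"
  by (simp add: upt_conv_Cons map_Suc_upt del: upt_Suc)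

lemma conv_pair_simps [simp]:
  "conv [[], []] = []"
  "conv [a # u, b # v] = [Some a, Some b] # conv [u, v]"
  "conv [a # u, []] = [Some a, None] # conv [u, []]"
  "conv [[], b # v] = [None, Some b] # conv [[], v]"
  by (simp_all add: conv_pair upt_0_Suc del: upt_Suc)

lemma conv_append: "conv [p @ u, p @ v] = map (\<lambda>s. [Some s, Some s]) p @ conv [u, v]"
  by (induction p) simp_all

lemma conv_map: "conv [map f u, map f v] = map (map (map_option f)) (conv [u, v])"
  by (simp add: conv_pair)

text \<open>Reading one track and dropping the padding inverts the convolution. Together with the
  second track this gives injectivity on pairs, which later allows single edges to be removed from a
  convolved relation.\<close>

lemma unconv_fst: "map the (filter (\<lambda>x. x \<noteq> None) (map hd (conv [u, v]))) = u"
proof (induction u arbitrary: v)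
  case Nil
  show ?case by (induction v) simp_all
next
  case (Cons a u)
  then show ?case by (cases v) simp_all
qed

lemma unconv_snd: "map the (filter (\<lambda>x. x \<noteq> None) (map (hd \<circ> tl) (conv [u, v]))) = v"
proof (induction v arbitrary: u)
  case Nil
  show ?case by (induction u) simp_all
next
  case (Cons a v)
  then show ?case by (cases u) simp_all
qed

lemma conv_pair_eq_iff: "conv [u, v] = conv [u', v'] \<longleftrightarrow> u = u' \<and> v = v'"
  by (metis unconv_fst unconv_snd)

lemma conv_pair_lists:
  assumes "u \<in> lists S" "v \<in> lists S"
  shows "conv [u, v] \<in> lists (conv_alphabet S 2)"
  using assms by (auto simp: conv_pair conv_alphabet_def dest: nth_mem)

lemma finite_conv_alphabet: "finite S \<Longrightarrow> finite (conv_alphabet S n)"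
  using finite_lists_length_eq[of "insert None (Some ` S)" n]
  by (simp add: conv_alphabet_def conj_commute)

text \<open>The length and alphabet conditions follow from \<open>L \<subseteq> lists S\<close>,
  leaving only the finiteness of the set of quotients.\<close>

lemma FA_recognizable_pairs:
  assumes "finite S" "L \<subseteq> lists S"
  shows "FA_recognizable S 2 {[u, v] | u v. u \<in> L \<and> v \<in> L \<and> P u v} \<longleftrightarrow>
    finite (quotients (conv ` {[u, v] | u v. u \<in> L \<and> v \<in> L \<and> P u v}))"
proof -
  have "{[u, v] | u v. u \<in> L \<and> v \<in> L \<and> P u v} \<subseteq> {ws. length ws = 2 \<and> set ws \<subseteq> lists S}"
    using assms(2) by auto
  moreover have "conv ` {[u, v] | u v. u \<in> L \<and> v \<in> L \<and> P u v} \<subseteq> lists (conv_alphabet S 2)"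
  proof
    fix z assume "z \<in> conv ` {[u, v] | u v. u \<in> L \<and> v \<in> L \<and> P u v}"
    then obtain u v where "u \<in> L" "v \<in> L" "z = conv [u, v]" by blast
    then show "z \<in> lists (conv_alphabet S 2)"
      using assms(2) conv_pair_lists[of u S v] by auto
  qed
  ultimately show ?thesis
    using finite_conv_alphabet[OF assms(1)]
    by (simp add: FA_recognizable_def regular_iff_finite_quotients)
qed

text \<open>\<open>E\<close> is meant as the edge relation of a factor, \<open>e\<close> as the
  representative of its identity, \<open>m\<close> as the marker and \<open>f\<close> as the
  recoding of symbols. The common prefix \<open>p\<close> becomes a diagonal word. Pairs avoiding
  \<open>e\<close> contribute the marker on both tracks and then the recoded convolution; the
  remaining pairs, where some code is empty, form a finite language.\<close>

lemma finite_quotients_conv_extend: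
  fixes E :: "('s list \<times> 's list) set" and f :: "'s \<Rightarrow> 't"
  defines "c \<equiv> \<lambda>e m f u. if u = e then [] else m # map f u"
  assumes P: "finite (quotients P)"
    and E: "finite (quotients ((\<lambda>(u, v). conv [u, v]) ` E))"
    and F: "finite {(u, v) \<in> E. u = e \<or> v = e}"
  shows "finite (quotients {conv [p @ c e m f u, p @ c e m f v] | p u v. p \<in> P \<and> (u, v) \<in> E})"
proof -
  define F where "F = {(u, v) \<in> E. u = e \<or> v = e}"
  \<comment> \<open>The pairs at \<open>e\<close> are removed before recoding, where
    \<open>conv\<close> is injective on pairs; afterwards a non-injective \<open>f\<close> could
    have merged different pairs.\<close>
  define K where "K = conc {[[Some m, Some m]]} (map (map (map_option f)) `
    ((\<lambda>(u, v). conv [u, v]) ` E - (\<lambda>(u, v). conv [u, v]) ` F))"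
  define J where "J = (\<lambda>(u, v). conv [c e m f u, c e m f v]) ` F"
  have K: "K = (\<lambda>(u, v). conv [c e m f u, c e m f v]) ` (E - F)"
  proof -
    have "(\<lambda>(u, v). conv [u, v]) ` E - (\<lambda>(u, v). conv [u, v]) ` F = (\<lambda>(u, v). conv [u, v]) ` (E - F)"
      by (rule inj_on_image_set_diff[symmetric, where C = E])
        (auto simp: inj_on_def conv_pair_eq_iff F_def)
    then have "K = (\<lambda>(u, v). [Some m, Some m] # map (map (map_option f)) (conv [u, v])) ` (E - F)"
      unfolding K_def by (simp add: image_image case_prod_unfold) (auto simp: conc_def)
    also have "\<dots> = (\<lambda>(u, v). conv [c e m f u, c e m f v]) ` (E - F)"
    proof (rule image_cong[OF refl])
      fix z assume "z \<in> E - F"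
      then obtain u v where "z = (u, v)" "u \<noteq> e" "v \<noteq> e" by (cases z) (auto simp: F_def)
      then show "(\<lambda>(u, v). [Some m, Some m] # map (map (map_option f)) (conv [u, v])) z =
        (\<lambda>(u, v). conv [c e m f u, c e m f v]) z"
        by (simp add: c_def conv_map)
    qed
    finally show ?thesis .
  qed
  have "E = (E - F) \<union> F" by (auto simp: F_def)
  then have KJ: "K \<union> J = (\<lambda>(u, v). conv [c e m f u, c e m f v]) ` E"
    unfolding K J_def by (simp flip: image_Un)
  have "{conv [p @ c e m f u, p @ c e m f v] | p u v. p \<in> P \<and> (u, v) \<in> E} =
    conc (map (\<lambda>s. [Some s, Some s]) ` P) (K \<union> J)"
    (is "?L = ?M")
  proof (rule equalityI; rule subsetI)
    fix w assume "w \<in> ?L"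
    then show "w \<in> ?M" unfolding KJ by (auto simp: conv_append intro!: concI)
  next
    fix w assume "w \<in> ?M"
    then obtain p u v where "p \<in> P" "(u, v) \<in> E" "w = conv [p @ c e m f u, p @ c e m f v]"
      unfolding KJ by (auto simp: conv_append elim!: concE)
    then show "w \<in> ?L" by blast
  qed
  moreover have "finite (quotients (conc (map (\<lambda>s. [Some s, Some s]) ` P) (K \<union> J)))"
    unfolding K_def J_def using F
    by (intro finite_quotients_conc finite_quotients_map finite_quotients_Un
        finite_quotients_Diff P E; intro finite_quotients_finite; simp add: F_def)
  ultimately show ?thesis by simp
qed

section \<open>Alternating words\<close>

text \<open>The word is read from the left in pairs of a letter with \<open>Q\<close> and one
  without. Since it does not end with \<open>Q\<close>, no half pair remains; an initial letter
  without \<open>Q\<close> is set aside first.\<close>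

lemma alternating_words:
  fixes Q :: "'s \<Rightarrow> bool"
  shows "{w \<in> lists D. successively (\<lambda>s t. Q s \<noteq> Q t) w \<and> (w = [] \<or> \<not> Q (last w))} =
    conc (insert [] {[s] | s. s \<in> D \<and> \<not> Q s})
      (star (conc {[s] | s. s \<in> D \<and> Q s} {[s] | s. s \<in> D \<and> \<not> Q s}))"
    (is "?W = conc (insert [] ?F) (star (conc ?T ?F))")
proof -
  have star: "w \<in> star (conc ?T ?F)" if "w \<in> ?W" "w = [] \<or> Q (hd w)" for w
    using that
  proof (induction w rule: induct_list012)
    case 1
    show ?case by (rule star.Nil)
  next
    \<comment> \<open>A single letter would be both first and last, hence both with and without
      \<open>Q\<close>.\<close>
    case (2 x)
    then show ?case by simp
  next
    case (3 s t w)
    from "3.prems" have st: "s \<in> D" "Q s" "t \<in> D" "\<not> Q t" by auto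
    have "w \<in> ?W" "w = [] \<or> Q (hd w)"
      using "3.prems" by (cases w; simp)+
    then have "w \<in> star (conc ?T ?F)" by (rule "3.IH"(1))
    moreover have "[s] @ [t] \<in> conc ?T ?F" using st by (intro concI) simp_all
    ultimately show ?case using star.append[of "[s] @ [t]"] by simp
  qed
  have W: "w \<in> ?W \<and> (w = [] \<or> Q (hd w))" if "w \<in> star (conc ?T ?F)" for w
    using that
  proof induction
    case (append u v)
    then obtain s t where "u = [s, t]" "s \<in> D" "Q s" "t \<in> D" "\<not> Q t"
      by (auto simp: conc_def)
    then show ?case using append.IH by (cases v) simp_all
  qed simp
  show ?thesis
  proof (rule equalityI; rule subsetI)
    fix w assume w: "w \<in> ?W"
    show "w \<in> conc (insert [] ?F) (star (conc ?T ?F))"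
    proof (cases "w = [] \<or> Q (hd w)")
      case True
      then have "[] @ w \<in> conc (insert [] ?F) (star (conc ?T ?F))"
        using star[OF w] by (intro concI) simp_all
      then show ?thesis by simp
    next
      case False
      then obtain s v where v: "w = [s] @ v" "\<not> Q s" by (cases w) auto
      then have "v \<in> ?W" "v = [] \<or> Q (hd v)" using w by (cases v; simp)+
      then have "v \<in> star (conc ?T ?F)" by (rule star)
      moreover have "[s] \<in> insert [] ?F" using v w by simp
      ultimately show ?thesis unfolding v(1) by (intro concI)
    qed
  next
    fix w assume "w \<in> conc (insert [] ?F) (star (conc ?T ?F))"
    then obtain u v where uv: "w = u @ v" "u \<in> insert [] ?F" "v \<in> star (conc ?T ?F)"
      by (rule concE)
    from W[OF uv(3)] uv(2) show "w \<in> ?W" unfolding uv(1) by (cases v) auto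
  qed
qed

section \<open>Images of alternating words under string homomorphisms\<close>

context
  fixes h :: "'s list \<Rightarrow> 't list"
  assumes h: "\<And>u v. h (u @ v) = h u @ h v"
begin

lemma image_conc: "h ` conc L M = conc (h ` L) (h ` M)"
proof (rule equalityI; rule subsetI)
  fix w assume "w \<in> h ` conc L M"
  then show "w \<in> conc (h ` L) (h ` M)" by (auto simp: h elim!: concE intro!: concI)
next
  fix w assume "w \<in> conc (h ` L) (h ` M)"
  then obtain u v where "u \<in> L" "v \<in> M" "w = h (u @ v)" by (auto simp: h elim!: concE)
  then show "w \<in> h ` conc L M" by (auto intro: concI)
qed

lemma image_star: "h ` star L = star (h ` L)"
proof
  have Nil: "h [] = []" using h[of "[]" "[]"] by simp
  show "h ` star L \<subseteq> star (h ` L)"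
  proof
    fix w assume "w \<in> h ` star L"
    then obtain v where "v \<in> star L" "w = h v" by blast
    then show "w \<in> star (h ` L)"
      by (induction arbitrary: w) (auto simp: h Nil intro: star.intros)
  qed
  show "star (h ` L) \<subseteq> h ` star L"
  proof
    fix w assume "w \<in> star (h ` L)"
    then show "w \<in> h ` star L"
    proof induction
      case Nil
      show ?case using \<open>h [] = []\<close> star.Nil by (metis image_eqI)
    next
      case (append u v)
      then obtain u' v' where "u' \<in> L" "v' \<in> star L" "u = h u'" "v = h v'" by blast
      then show ?case by (metis h image_eqI star.append)
    qed
  qed
qed

text \<open>\<open>D\<close> may be infinite, as the letter set of a free product is when a factor
  is infinite. Pushing \<open>h\<close> through concatenation and star leaves only the codes of
  single letters to be considered.\<close>

lemma finite_quotients_alternating: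
  assumes T: "finite (quotients (h ` {[s] | s. s \<in> D \<and> Q s}))"
    and F: "finite (quotients (h ` {[s] | s. s \<in> D \<and> \<not> Q s}))"
  shows "finite (quotients (h `
    {w \<in> lists D. successively (\<lambda>s t. Q s \<noteq> Q t) w \<and> (w = [] \<or> \<not> Q (last w))}))"
  using T F unfolding alternating_words image_conc image_star image_insert
  by (intro finite_quotients_conc finite_quotients_star finite_quotients_insert)

end

section \<open>Right multiplication in free products\<close>

lemma fp_words_append:
  "u @ v \<in> fp_words A B \<longleftrightarrow>
     u \<in> fp_words A B \<and> v \<in> fp_words A B \<and>
     (u = [] \<or> v = [] \<or> isl (last u) \<noteq> isl (hd v))"
  by (auto simp: fp_words_def successively_append_iff)

lemma fp_inl_words: "a \<in> carrier A \<Longrightarrow> fp_inl A a \<in> fp_words A B"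
  and fp_inr_words: "b \<in> carrier B \<Longrightarrow> fp_inr B b \<in> fp_words A B"
  by (auto simp: fp_inl_def fp_inr_def fp_words_Cons)

text \<open>A last letter from \<open>A\<close> is split off; a word without one gets the identity
  as \<open>a\<close>, which \<open>fp_inl\<close> maps to the empty word.\<close>

lemma fp_words_split_inl:
  assumes "w \<in> fp_words A B" "\<one>\<^bsub>A\<^esub> \<in> carrier A"
  obtains p a where "p \<in> fp_words A B" "p = [] \<or> \<not> isl (last p)" "a \<in> carrier A"
    "w = p @ fp_inl A a"
proof (cases "w = [] \<or> \<not> isl (last w)")
  case True
  then show ?thesis using assms that[of w "\<one>\<^bsub>A\<^esub>"] by (simp add: fp_inl_def)
next
  case False
  then obtain p a where w: "w = p @ [Inl a]"
    by (cases w rule: rev_cases; cases "last w") auto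
  then show ?thesis using assms that[of p a]
    by (auto simp: fp_words_append fp_words_Cons fp_inl_def)
qed

lemma fp_words_split_inr:
  assumes "w \<in> fp_words A B" "\<one>\<^bsub>B\<^esub> \<in> carrier B"
  obtains p b where "p \<in> fp_words A B" "p = [] \<or> isl (last p)" "b \<in> carrier B"
    "w = p @ fp_inr B b"
proof (cases "w = [] \<or> isl (last w)")
  case True
  then show ?thesis using assms that[of w "\<one>\<^bsub>B\<^esub>"] by (simp add: fp_inr_def)
next
  case False
  then obtain p b where w: "w = p @ [Inr b]"
    by (cases w rule: rev_cases; cases "last w") auto
  then show ?thesis using assms that[of p b]
    by (auto simp: fp_words_append fp_words_Cons fp_inr_def)
qed

context
  fixes A :: "('a, 'm) monoid_scheme" and B :: "('b, 'n) monoid_scheme"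
  assumes A: "group A" and B: "group B"
begin

interpretation A: group A by (rule A)
interpretation B: group B by (rule B)
interpretation AB: group "A \<star> B" by (rule group_free_product[OF A B])

text \<open>No cancellation can occur: folding \<open>u @ v\<close> into the empty word returns
  \<open>u @ v\<close>, and that fold first passes through \<open>v\<close>, which it returns as
  well.\<close>

lemma fp_mult_append:
  assumes "u @ v \<in> fp_words A B"
  shows "u \<otimes>\<^bsub>A \<star> B\<^esub> v = u @ v"
  using foldr_fp_cons_Nil[OF A B assms] foldr_fp_cons_Nil[OF A B, of v] assms
  by (simp add: fp_words_append)

text \<open>The images of \<open>X\<close> and \<open>Y\<close> generate the images of both factors,
  thus all one-letter words, and a reduced word is the product of its letters.\<close>

lemma generate_free_product:
  assumes X: "X \<subseteq> carrier A" "generate A X = carrier A"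
    and Y: "Y \<subseteq> carrier B" "generate B Y = carrier B"
  shows "generate (A \<star> B) (fp_inl A ` X \<union> fp_inr B ` Y) = carrier (A \<star> B)"
    (is "generate _ ?Z = _")
proof
  interpret inl: group_hom A "A \<star> B" "fp_inl A"
    by unfold_locales (rule fp_inl_hom[OF A B])
  interpret inr: group_hom B "A \<star> B" "fp_inr B"
    by unfold_locales (rule fp_inr_hom[OF A B])
  have "?Z \<subseteq> carrier (A \<star> B)"
    using X(1) Y(1) by (auto simp: fp_inl_words fp_inr_words)
  then show "generate (A \<star> B) ?Z \<subseteq> carrier (A \<star> B)" by (rule AB.generate_incl)
  have inl: "fp_inl A a \<in> generate (A \<star> B) ?Z" if "a \<in> carrier A" for a
    using inl.generate_img[OF X(1)] X(2) AB.mono_generate[of "fp_inl A ` X" ?Z] that by blast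
  have inr: "fp_inr B b \<in> generate (A \<star> B) ?Z" if "b \<in> carrier B" for b
    using inr.generate_img[OF Y(1)] Y(2) AB.mono_generate[of "fp_inr B ` Y" ?Z] that by blast
  show "carrier (A \<star> B) \<subseteq> generate (A \<star> B) ?Z"
  proof
    fix w assume "w \<in> carrier (A \<star> B)"
    then have "w \<in> fp_words A B" by simp
    then show "w \<in> generate (A \<star> B) ?Z"
    proof (induction w)
      case Nil
      show ?case using generate.one[of "A \<star> B"] by simp
    next
      case (Cons s w)
      have "[s] \<in> generate (A \<star> B) ?Z"
      proof (cases s)
        case (Inl a)
        then show ?thesis using Cons.prems inl[of a] by (simp add: fp_words_Cons fp_inl_def)
      next
        case (Inr b)
        then show ?thesis using Cons.prems inr[of b] by (simp add: fp_words_Cons fp_inr_def)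
      qed
      moreover have "w \<in> generate (A \<star> B) ?Z"
        using Cons by (simp add: fp_words_Cons)
      ultimately have "[s] \<otimes>\<^bsub>A \<star> B\<^esub> w \<in> generate (A \<star> B) ?Z" by (rule generate.eng)
      then show ?case using fp_mult_append[of "[s]" w] Cons.prems by simp
    qed
  qed
qed

text \<open>Serves both factors: \<open>C\<close> is to be one of them, \<open>\<iota>\<close> its
  embedding and \<open>P\<close> the set of reduced words not ending in it. Right multiplication by
  \<open>\<iota> x\<close> leaves \<open>p\<close> alone and acts on \<open>a\<close> within
  \<open>C\<close>, so the edges have the shape treated by
  \<open>finite_quotients_conv_extend\<close>.\<close>

lemma finite_quotients_fp_edges:
  fixes C :: "('c, 'k) monoid_scheme" and enc :: "('a + 'b) list \<Rightarrow> nat list"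
  defines "W \<equiv> fp_words A B"
  assumes C: "group C" and \<iota>: "\<iota> \<in> hom C (A \<star> B)"
    and closed: "\<And>p a. p \<in> P \<Longrightarrow> a \<in> carrier C \<Longrightarrow> p @ \<iota> a \<in> W"
    and split: "\<And>w. w \<in> W \<Longrightarrow> \<exists>p\<in>P. \<exists>a\<in>carrier C. w = p @ \<iota> a"
    and inj: "inj_on enc W" and P: "finite (quotients (enc ` P))"
    and \<nu>: "bij_betw \<nu> R (carrier C)" and e: "e \<in> R" "\<nu> e = \<one>\<^bsub>C\<^esub>"
    and enc: "\<And>p u. p \<in> P \<Longrightarrow> u \<in> R \<Longrightarrow>
      enc (p @ \<iota> (\<nu> u)) = enc p @ (if u = e then [] else m # map f u)"
    and x: "x \<in> carrier C"
    and FA: "FA_recognizable S 2 {[u, v] | u v. u \<in> R \<and> v \<in> R \<and> \<nu> u \<otimes>\<^bsub>C\<^esub> x = \<nu> v}"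
  shows "finite (quotients (conv ` {[u, v] | u v. u \<in> enc ` W \<and> v \<in> enc ` W \<and>
    inv_into W enc u \<otimes>\<^bsub>A \<star> B\<^esub> \<iota> x = inv_into W enc v}))"
proof -
  interpret C: group C by (rule C)
  define E where "E = {(u, v). u \<in> R \<and> v \<in> R \<and> \<nu> u \<otimes>\<^bsub>C\<^esub> x = \<nu> v}"
  let ?c = "\<lambda>u. if u = e then [] else m # map f u"
  have \<iota>_W: "\<iota> a \<in> W" if "a \<in> carrier C" for a
    using hom_in_carrier[OF \<iota> that] by (simp add: W_def)
  have P_W: "p \<in> W" if "p \<in> P" for p
    using closed[OF that, of "\<one>\<^bsub>C\<^esub>"] by (simp add: W_def fp_words_append)
  have \<nu>_R: "\<nu> u \<in> carrier C" if "u \<in> R" for u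
    using \<nu> that by (auto simp: bij_betw_def)
  have "(\<lambda>(u, v). conv [u, v]) ` E =
      conv ` {[u, v] | u v. u \<in> R \<and> v \<in> R \<and> \<nu> u \<otimes>\<^bsub>C\<^esub> x = \<nu> v}"
    by (auto simp: E_def)
  then have E: "finite (quotients ((\<lambda>(u, v). conv [u, v]) ` E))"
    using FA by (simp add: FA_recognizable_def regular_iff_finite_quotients)
  have F: "finite {(u, v) \<in> E. u = e \<or> v = e}"
  proof (rule finite_subset)
    \<comment> \<open>An edge labelled \<open>x\<close> is determined by either endpoint: from the
      identity it leads to \<open>x\<close>, and into the identity it comes from the inverse of
      \<open>x\<close>.\<close>
    define u0 where "u0 = inv_into R \<nu> (inv\<^bsub>C\<^esub> x)"
    define v0 where "v0 = inv_into R \<nu> x"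
    have u0: "u = u0" if "u \<in> R" "\<nu> u \<otimes>\<^bsub>C\<^esub> x = \<one>\<^bsub>C\<^esub>" for u
      using that x \<nu> \<nu>_R C.inv_equality[of "\<nu> u" x]
      by (simp add: u0_def bij_betw_def inv_into_f_f)
    have v0: "v = v0" if "v \<in> R" "x = \<nu> v" for v
      using that \<nu> by (simp add: v0_def bij_betw_def inv_into_f_f)
    show "{(u, v) \<in> E. u = e \<or> v = e} \<subseteq> {(e, v0), (u0, e)}"
      using e x by (auto simp: E_def intro: u0 v0)
  qed simp
  \<comment> \<open>By \<open>closed\<close>, \<open>p\<close> followed by the image of any element
    of \<open>C\<close> is reduced, even if that element is trivial; so cancellation happens only
    inside \<open>C\<close>.\<close>
  have mult: "(p @ \<iota> a) \<otimes>\<^bsub>A \<star> B\<^esub> \<iota> x = p @ \<iota> (a \<otimes>\<^bsub>C\<^esub> x)"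
    if "p \<in> P" "a \<in> carrier C" for p a
  proof -
    have "(p @ \<iota> a) \<otimes>\<^bsub>A \<star> B\<^esub> \<iota> x = (p \<otimes>\<^bsub>A \<star> B\<^esub> \<iota> a) \<otimes>\<^bsub>A \<star> B\<^esub> \<iota> x"
      using that closed fp_mult_append by (simp add: W_def)
    also have "\<dots> = p \<otimes>\<^bsub>A \<star> B\<^esub> (\<iota> a \<otimes>\<^bsub>A \<star> B\<^esub> \<iota> x)"
      using that x P_W \<iota>_W W_def by (intro AB.m_assoc) simp_all
    also have "\<dots> = p \<otimes>\<^bsub>A \<star> B\<^esub> \<iota> (a \<otimes>\<^bsub>C\<^esub> x)"
      using hom_mult[OF \<iota> that(2) x] by simp
    also have "\<dots> = p @ \<iota> (a \<otimes>\<^bsub>C\<^esub> x)"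
      using that x closed by (intro fp_mult_append) (simp add: W_def)
    finally show ?thesis .
  qed
  \<comment> \<open>By \<open>split\<close>, every edge starts at some \<open>p @ \<iota> a\<close>,
    and by \<open>mult\<close> it ends at a word with the same \<open>p\<close>.\<close>
  have "conv ` {[u, v] | u v. u \<in> enc ` W \<and> v \<in> enc ` W \<and>
      inv_into W enc u \<otimes>\<^bsub>A \<star> B\<^esub> \<iota> x = inv_into W enc v} =
    {conv [p @ ?c u, p @ ?c v] | p u v. p \<in> enc ` P \<and> (u, v) \<in> E}" (is "?L = ?M")
  proof (rule equalityI; rule subsetI)
    fix z assume "z \<in> ?L"
    then obtain w w' where w: "w \<in> W" "w' \<in> W" "z = conv [enc w, enc w']"
      and "inv_into W enc (enc w) \<otimes>\<^bsub>A \<star> B\<^esub> \<iota> x = inv_into W enc (enc w')"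
      by blast
    then have w': "w' = w \<otimes>\<^bsub>A \<star> B\<^esub> \<iota> x" by (simp only: inv_into_f_f[OF inj])
    obtain p a where p: "p \<in> P" "a \<in> carrier C" "w = p @ \<iota> a" using split[OF w(1)] by blast
    obtain u where u: "u \<in> R" "a = \<nu> u" using \<nu> p(2) by (auto simp: bij_betw_def)
    obtain v where v: "v \<in> R" "a \<otimes>\<^bsub>C\<^esub> x = \<nu> v"
      using \<nu> C.m_closed[OF p(2) x] by (metis bij_betw_imp_surj_on imageE)
    have "z = conv [enc p @ ?c u, enc p @ ?c v]"
      using mult[OF p(1,2)] enc[OF p(1)] w(3) w' p(3) u v by simp
    moreover have "(u, v) \<in> E" using u v by (simp add: E_def)
    ultimately show "z \<in> ?M" using p(1) by blast
  next
    fix z assume "z \<in> ?M"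
    then obtain p u v where p: "p \<in> P" "(u, v) \<in> E" "z = conv [enc p @ ?c u, enc p @ ?c v]"
      by blast
    have uv: "u \<in> R" "v \<in> R" "\<nu> u \<otimes>\<^bsub>C\<^esub> x = \<nu> v" using p(2) by (auto simp: E_def)
    have W: "p @ \<iota> (\<nu> u) \<in> W" "p @ \<iota> (\<nu> v) \<in> W"
      using closed p(1) uv \<nu>_R by auto
    have "z = conv [enc (p @ \<iota> (\<nu> u)), enc (p @ \<iota> (\<nu> v))]"
      using p enc uv by simp
    moreover have "inv_into W enc (enc (p @ \<iota> (\<nu> u))) \<otimes>\<^bsub>A \<star> B\<^esub> \<iota> x =
        inv_into W enc (enc (p @ \<iota> (\<nu> v)))"
      using mult[OF p(1) \<nu>_R[OF uv(1)]] uv(3) by (simp only: inv_into_f_f[OF inj] W)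
    ultimately show "z \<in> ?L" using W by blast
  qed
  then show ?thesis using finite_quotients_conv_extend[OF P E F, of m f] by simp
qed

end

section \<open>The encoding of reduced words\<close>

text \<open>The markers are 0 and 1; symbols of the first factor become even numbers from 2 on,
  those of the second odd numbers from 3 on, so nothing clashes.\<close>

definition fp_code :: "('a \<Rightarrow> nat list) \<Rightarrow> ('b \<Rightarrow> nat list) \<Rightarrow> ('a + 'b) list \<Rightarrow> nat list" where
  "fp_code f g = concat \<circ> map (case_sum (\<lambda>a. 0 # map (\<lambda>s. 2 * s + 2) (f a))
                                      (\<lambda>b. 1 # map (\<lambda>s. 2 * s + 3) (g b)))"

lemma fp_code_simps [simp]:
  "fp_code f g [] = []"
  "fp_code f g (Inl a # w) = 0 # map (\<lambda>s. 2 * s + 2) (f a) @ fp_code f g w"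
  "fp_code f g (Inr b # w) = 1 # map (\<lambda>s. 2 * s + 3) (g b) @ fp_code f g w"
  "fp_code f g (u @ v) = fp_code f g u @ fp_code f g v"
  by (simp_all add: fp_code_def)

text \<open>Markers are the only symbols below 2, so a block ends where the next marker stands, and
  the marker tells the factor. A letter stays visible even if its representative is the empty
  string.\<close>

lemma fp_code_inj:
  assumes f: "inj_on f X" and g: "inj_on g Y"
  shows "inj_on (fp_code f g) (lists (Inl ` X \<union> Inr ` Y))"
proof -
  \<comment> \<open>What follows a block is empty or begins with a marker, so
    \<open>takeWhile\<close> cuts off exactly the block.\<close>
  have tw: "takeWhile (\<lambda>n. 2 \<le> n) (fp_code f g w) = []" for w
  proof (cases w)
    case (Cons s v)
    then show ?thesis by (cases s) simp_all
  qed simp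
  have takeWhile: "takeWhile (\<lambda>n. 2 \<le> n) (map h z @ fp_code f g w) = map h z"
    if "\<And>s. 2 \<le> h s" for h :: "nat \<Rightarrow> nat" and z w
    using that by (induction z) (simp_all add: tw)
  have cancel: "z = z' \<and> fp_code f g w = fp_code f g w'"
    if "map h z @ fp_code f g w = map h z' @ fp_code f g w'" "\<And>s. 2 \<le> h s" "inj h"
    for h :: "nat \<Rightarrow> nat" and z z' w w'
  proof -
    have "map h z = map h z'"
      using that(1) takeWhile[of h z w] takeWhile[of h z' w'] that(2) by simp
    then show ?thesis using that(1,3) by (simp add: inj_map_eq_map)
  qed
  have "u = v" if "u \<in> lists (Inl ` X \<union> Inr ` Y)" "v \<in> lists (Inl ` X \<union> Inr ` Y)"
    "fp_code f g u = fp_code f g v" for u v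
    using that
  proof (induction u arbitrary: v rule: list.induct)
    case Nil
    show ?case
    proof (cases v)
      case (Cons t v')
      then show ?thesis using Nil by (cases t) simp_all
    qed simp
  next
    case (Cons s u)
    then obtain t v' where v: "v = t # v'" by (cases v; cases s) auto
    consider a a' where "s = Inl a" "t = Inl a'" | b b' where "s = Inr b" "t = Inr b'"
      using Cons.prems(3) v by (cases s; cases t) auto
    then show ?case
    proof cases
      case 1
      then have "f a = f a' \<and> fp_code f g u = fp_code f g v'"
        using Cons.prems(3) v by (intro cancel[of "\<lambda>s. 2 * s + 2"]) (auto simp: inj_def)
      moreover have "a \<in> X" "a' \<in> X" using Cons.prems 1 v by auto
      ultimately show ?thesis using Cons.IH[of v'] Cons.prems 1 v f by (auto dest: inj_onD)
    next
      case 2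
      then have "g b = g b' \<and> fp_code f g u = fp_code f g v'"
        using Cons.prems(3) v by (intro cancel[of "\<lambda>s. 2 * s + 3"]) (auto simp: inj_def)
      moreover have "b \<in> Y" "b' \<in> Y" using Cons.prems 2 v by auto
      ultimately show ?thesis using Cons.IH[of v'] Cons.prems 2 v g by (auto dest: inj_onD)
    qed
  qed
  then show ?thesis by (intro inj_onI)
qed

lemma fp_code_lists:
  assumes "w \<in> fp_words A B"
    and "\<And>a. a \<in> carrier A \<Longrightarrow> f a \<in> lists S" "\<And>b. b \<in> carrier B \<Longrightarrow> g b \<in> lists T"
  shows "fp_code f g w \<in> lists ({0, 1} \<union> (\<lambda>s. 2 * s + 2) ` S \<union> (\<lambda>s. 2 * s + 3) ` T)"
  using assms(1)
proof (induction w)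
  case (Cons s w)
  show ?case
  proof (cases s)
    case (Inl a)
    then show ?thesis using Cons assms(2)[of a] by (auto simp: fp_words_Cons)
  next
    case (Inr b)
    then show ?thesis using Cons assms(3)[of b] by (auto simp: fp_words_Cons)
  qed
qed simp

section \<open>The graph automatic structure of the free product\<close>

lemma graph_automaticE:
  assumes "graph_automatic G"
  obtains X and S :: "nat set" and R \<nu> where "group G" "finite X" "X \<subseteq> carrier G" "generate G X = carrier G"
    "finite S" "R \<subseteq> lists S" "finite (quotients R)" "bij_betw \<nu> R (carrier G)"
    "\<forall>x\<in>X.
      FA_recognizable S 2 {[u, v] | u v. u \<in> R \<and> v \<in> R \<and> \<nu> u \<otimes>\<^bsub>G\<^esub> x = \<nu> v}"
  using assms
  unfolding graph_automatic_def graph_automatic_wrt_def regular_iff_finite_quotients by blast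

theorem theorem10p8:
  fixes A :: "('a, 'm) monoid_scheme" and B :: "('b, 'n) monoid_scheme"
  assumes "graph_automatic A" and "graph_automatic B"
  shows "graph_automatic (A \<star> B)"
proof -
  obtain X and S :: "nat set" and R \<nu> where A: "group A" and X: "finite X" "X \<subseteq> carrier A" "generate A X = carrier A"
    and S: "finite S" "R \<subseteq> lists S" and R: "finite (quotients R)"
    and \<nu>: "bij_betw \<nu> R (carrier A)"
    and FA_A: "\<forall>x\<in>X.
      FA_recognizable S 2 {[u, v] | u v. u \<in> R \<and> v \<in> R \<and> \<nu> u \<otimes>\<^bsub>A\<^esub> x = \<nu> v}"
    by (rule graph_automaticE[OF assms(1)])
  obtain Y and T :: "nat set" and R' \<nu>' where B: "group B" and Y: "finite Y" "Y \<subseteq> carrier B" "generate B Y = carrier B"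
    and T: "finite T" "R' \<subseteq> lists T" and R': "finite (quotients R')"
    and \<nu>': "bij_betw \<nu>' R' (carrier B)"
    and FA_B: "\<forall>y\<in>Y.
      FA_recognizable T 2 {[u, v] | u v. u \<in> R' \<and> v \<in> R' \<and> \<nu>' u \<otimes>\<^bsub>B\<^esub> y = \<nu>' v}"
    by (rule graph_automaticE[OF assms(2)])
  interpret A: group A by (rule A)
  interpret B: group B by (rule B)

  \<comment> \<open>\<open>\<mu>\<close> and \<open>\<mu>'\<close> choose the representative of an
    element. The codes of \<open>W\<close> over the alphabet \<open>U\<close> will represent the
    free product, with \<open>inv_into W enc\<close> as the bijection and \<open>Z\<close> as the
    generating set.\<close>
  define \<mu> where "\<mu> = inv_into R \<nu>"
  define \<mu>' where "\<mu>' = inv_into R' \<nu>'"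
  define enc where "enc = fp_code \<mu> \<mu>'"
  define W where "W = fp_words A B"
  define U where "U = {0, 1} \<union> (\<lambda>s. 2 * s + 2) ` S \<union> (\<lambda>s. 2 * s + 3) ` T"
  define Z where "Z = fp_inl A ` X \<union> fp_inr B ` Y"

  have bij: "bij_betw \<mu> (carrier A) R" "bij_betw \<mu>' (carrier B) R'"
    unfolding \<mu>_def \<mu>'_def by (rule bij_betw_inv_into, rule \<nu> \<nu>')+
  have inv: "\<And>u. u \<in> R \<Longrightarrow> \<mu> (\<nu> u) = u" "\<And>u. u \<in> R' \<Longrightarrow> \<mu>' (\<nu>' u) = u"
    unfolding \<mu>_def \<mu>'_def using \<nu> \<nu>' by (auto intro: bij_betw_inv_into_left)
  have inv': "\<And>a. a \<in> carrier A \<Longrightarrow> \<nu> (\<mu> a) = a" "\<And>b. b \<in> carrier B \<Longrightarrow> \<nu>' (\<mu>' b) = b"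
    unfolding \<mu>_def \<mu>'_def using \<nu> \<nu>' by (auto intro: bij_betw_inv_into_right)
  have e: "\<mu> \<one>\<^bsub>A\<^esub> \<in> R" "\<mu>' \<one>\<^bsub>B\<^esub> \<in> R'"
    using bij by (auto simp: bij_betw_def)
  have inj: "inj_on enc W"
    unfolding enc_def
  proof (rule inj_on_subset[OF fp_code_inj])
    show "inj_on \<mu> (carrier A)" "inj_on \<mu>' (carrier B)"
      using bij by (auto simp: bij_betw_def)
    show "W \<subseteq> lists (Inl ` carrier A \<union> Inr ` carrier B)"
      by (auto simp: W_def fp_words_def fp_letters_def)
  qed

  \<comment> \<open>Letters exclude the identity, so their codes come from \<open>R\<close> with one
    word deleted.\<close>
  have KA: "finite (quotients (enc ` {[s] | s. s \<in> fp_letters A B \<and> isl s}))"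
  proof -
    have "\<mu> ` (carrier A - {\<one>\<^bsub>A\<^esub>}) = R - {\<mu> \<one>\<^bsub>A\<^esub>}"
      using bij(1) inj_on_image_set_diff[of \<mu> "carrier A" "carrier A" "{\<one>\<^bsub>A\<^esub>}"]
      by (simp add: bij_betw_def)
    moreover have "enc ` {[s] | s. s \<in> fp_letters A B \<and> isl s} =
        conc {[0]} (map (\<lambda>s. 2 * s + 2) ` \<mu> ` (carrier A - {\<one>\<^bsub>A\<^esub>}))"
    proof -
      have "{[s] | s. s \<in> fp_letters A B \<and> isl s} = (\<lambda>a. [Inl a]) ` (carrier A - {\<one>\<^bsub>A\<^esub>})"
        by (auto simp: fp_letters_def)
      then show ?thesis by (simp add: image_image enc_def conc_singleton)
    qed
    ultimately show ?thesis
      by (simp only:)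
        (intro finite_quotients_conc finite_quotients_map finite_quotients_Diff R;
          intro finite_quotients_finite; simp)
  qed
  have KB: "finite (quotients (enc ` {[s] | s. s \<in> fp_letters A B \<and> \<not> isl s}))"
  proof -
    have "\<mu>' ` (carrier B - {\<one>\<^bsub>B\<^esub>}) = R' - {\<mu>' \<one>\<^bsub>B\<^esub>}"
      using bij(2) inj_on_image_set_diff[of \<mu>' "carrier B" "carrier B" "{\<one>\<^bsub>B\<^esub>}"]
      by (simp add: bij_betw_def)
    moreover have "enc ` {[s] | s. s \<in> fp_letters A B \<and> \<not> isl s} =
        conc {[1]} (map (\<lambda>s. 2 * s + 3) ` \<mu>' ` (carrier B - {\<one>\<^bsub>B\<^esub>}))"
    proof -
      have "{[s] | s. s \<in> fp_letters A B \<and> \<not> isl s} = (\<lambda>a. [Inr a]) ` (carrier B - {\<one>\<^bsub>B\<^esub>})"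
        by (auto simp: fp_letters_def)
      then show ?thesis by (simp add: image_image enc_def conc_singleton)
    qed
    ultimately show ?thesis
      by (simp only:)
        (intro finite_quotients_conc finite_quotients_map finite_quotients_Diff R';
          intro finite_quotients_finite; simp)
  qed

  define PA where "PA = {w \<in> W. w = [] \<or> \<not> isl (last w)}"
  define PB where "PB = {w \<in> W. w = [] \<or> isl (last w)}"
  have enc_append: "enc (u @ v) = enc u @ enc v" for u v by (simp add: enc_def)
  have PA: "finite (quotients (enc ` PA))"
    using finite_quotients_alternating[of enc "fp_letters A B" isl, OF enc_append KA KB]
    by (simp add: PA_def W_def fp_words_def conj_assoc)
  \<comment> \<open>With the negated predicate the two factors exchange roles.\<close>
  have PB: "finite (quotients (enc ` PB))"
    using finite_quotients_alternating[of enc "fp_letters A B" "\<lambda>s. \<not> isl s", OF enc_append]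
      KA KB by (simp add: PB_def W_def fp_words_def conj_assoc)

  \<comment> \<open>The regularity of the whole code language comes from the two prefix languages
    that the edge relations use.\<close>
  have "W = PA \<union> PB" by (auto simp: PA_def PB_def)
  then have "finite (quotients (enc ` W))"
    using finite_quotients_Un[OF PA PB] by (simp add: image_Un)
  moreover have encW: "enc ` W \<subseteq> lists U"
  proof -
    have "\<mu> a \<in> lists S" if "a \<in> carrier A" for a using bij(1) S(2) that by (auto simp: bij_betw_def)
    moreover have "\<mu>' b \<in> lists T" if "b \<in> carrier B" for b using bij(2) T(2) that by (auto simp: bij_betw_def)
    ultimately show ?thesis
      unfolding W_def enc_def U_def by (intro image_subsetI fp_code_lists)
  qed
  moreover have U: "finite U" using S T by (simp add: U_def)
  ultimately have regular: "regular U (enc ` W)" by (simp add: regular_iff_finite_quotients)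

  have split_A: "\<exists>p\<in>PA. \<exists>a\<in>carrier A. w = p @ fp_inl A a" if "w \<in> W" for w
    using that unfolding W_def by (rule fp_words_split_inl) (auto simp: PA_def W_def)
  have split_B: "\<exists>p\<in>PB. \<exists>b\<in>carrier B. w = p @ fp_inr B b" if "w \<in> W" for w
    using that unfolding W_def by (rule fp_words_split_inr) (auto simp: PB_def W_def)
  have edges_A: "finite (quotients (conv ` {[u, v] | u v. u \<in> enc ` W \<and> v \<in> enc ` W \<and>
      inv_into W enc u \<otimes>\<^bsub>A \<star> B\<^esub> fp_inl A x = inv_into W enc v}))" if "x \<in> X" for x
  proof (rule finite_quotients_fp_edges[OF A B A fp_inl_hom[OF A B] _ _ _ PA \<nu> e(1) _ _ _ FA_A[rule_format, OF that],
        folded W_def])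
    show "p @ fp_inl A a \<in> W" if "p \<in> PA" "a \<in> carrier A" for p a
      using that by (auto simp: PA_def W_def fp_inl_def fp_words_append fp_words_Cons)
    \<comment> \<open>\<open>u\<close> is the representative of the identity exactly when
      \<open>\<nu> u\<close> is the identity, and then \<open>fp_inl\<close> contributes no
      letter.\<close>
    show "enc (p @ fp_inl A (\<nu> u)) =
        enc p @ (if u = \<mu> \<one>\<^bsub>A\<^esub> then [] else 0 # map (\<lambda>s. 2 * s + 2) u)"
      if "p \<in> PA" "u \<in> R" for p u
      using that inv(1)[of u] inv'(1) by (auto simp: enc_append fp_inl_def) (simp_all add: enc_def)
  qed (use split_A inj inv'(1) that X(2) in auto)
  have edges_B: "finite (quotients (conv ` {[u, v] | u v. u \<in> enc ` W \<and> v \<in> enc ` W \<and>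
      inv_into W enc u \<otimes>\<^bsub>A \<star> B\<^esub> fp_inr B y = inv_into W enc v}))" if "y \<in> Y" for y
  proof (rule finite_quotients_fp_edges[OF A B B fp_inr_hom[OF A B] _ _ _ PB \<nu>' e(2) _ _ _ FA_B[rule_format, OF that],
        folded W_def])
    show "p @ fp_inr B b \<in> W" if "p \<in> PB" "b \<in> carrier B" for p b
      using that by (auto simp: PB_def W_def fp_inr_def fp_words_append fp_words_Cons)
    show "enc (p @ fp_inr B (\<nu>' u)) =
        enc p @ (if u = \<mu>' \<one>\<^bsub>B\<^esub> then [] else 1 # map (\<lambda>s. 2 * s + 3) u)"
      if "p \<in> PB" "u \<in> R'" for p u
      using that inv(2)[of u] inv'(2) by (auto simp: enc_append fp_inr_def) (simp_all add: enc_def)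
  qed (use split_B inj inv'(2) that Y(2) in auto)

  have FA: "FA_recognizable U 2 {[u, v] | u v. u \<in> enc ` W \<and> v \<in> enc ` W \<and>
      inv_into W enc u \<otimes>\<^bsub>A \<star> B\<^esub> z = inv_into W enc v}" if "z \<in> Z" for z
  proof -
    from that consider x where "x \<in> X" "z = fp_inl A x" | y where "y \<in> Y" "z = fp_inr B y"
      by (auto simp: Z_def)
    then show ?thesis
      unfolding FA_recognizable_pairs[OF U encW] by cases (simp_all only: edges_A edges_B)
  qed
  have "graph_automatic_wrt (A \<star> B) Z"
    unfolding graph_automatic_wrt_def
  proof (intro exI conjI ballI)
    show "bij_betw (inv_into W enc) (enc ` W) (carrier (A \<star> B))"
      using bij_betw_inv_into[OF inj_on_imp_bij_betw[OF inj]] by (simp add: W_def)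
  qed (fact U regular FA)+
  moreover have "generate (A \<star> B) Z = carrier (A \<star> B)"
    unfolding Z_def by (rule generate_free_product[OF A B X(2,3) Y(2,3)])
  moreover have "Z \<subseteq> carrier (A \<star> B)"
    using X(2) Y(2) by (auto simp: Z_def fp_inl_words fp_inr_words)
  moreover have "finite Z" using X(1) Y(1) by (simp add: Z_def)
  ultimately show ?thesis
    unfolding graph_automatic_def using group_free_product[OF A B] by blast
qed

end
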